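(* Let $I$ be a solvable search instance (with nonnegative edge costs) whose heuristic $h$ is consistent, zero at goals, and strictly positive at every non-goal. Then for every fixed $0\le\alpha<1$, every tie-breaker $\tau$, and every random outcome $\rho$, the set of non-goal states expanded by weighted A* with evaluation function $f_\alpha=g+\alpha h$ satisfies $$E_{\alpha,\tau}(I;\rho)=S_<^{(\alpha)}=\{v\notin\mathcal G: g^*(v)+\alpha h(v)<C^*\}.$$ Thus both the expanded set and the expansion count are independent of tie-breaking.
   Context: **Search instances.** A search instance is $I=(V,A,c,s,\mathcal G,h)$ with $(V,A)$ a finite directed graph, $c:A\to\mathbb R_{\ge0}$ edge costs, $s\notin\mathcal G$ the initial state, $\mathcal G\subseteq V$ the goals, $h:V\to\mathbb R$ a heuristic, together with a fixed order in which successors of each state are generated. $g^*(v)$ is the least cost of a path from $s$ to $v$ ($+\infty$ if none), $h^*(v)$ the least cost of a path from $v$ to a goal ($+\infty$ if none). The instance is solvable if $C^*:=h^*(s)<\infty$. $h$ is consistent if $h(u)\le c(u,v)+h(v)$ for all $(u,v)\in A$. **Weighted A\* model.** Fix $0\le\alpha\le1$ and $f_\alpha=g+\alpha h$. Initially OPEN contains only $s$ with $g(s)=0$, and CLOSED is empty. Each OPEN entry stores its best known $g$-value, parent, first-insertion timestamp and goal status. At a selection point let $\mathrm{OPEN}_{\min}$ be the set of $v\in\mathrm{OPEN}$ minimizing $f_\alpha(v)=g(v)+\alpha h(v)$. If $\mathrm{OPEN}_{\min}$ contains a goal, a goal is selected and the search terminates (goal preference; selecting a goal is not an expansion). Otherwise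 the tie-breaker selects a non-goal in $\mathrm{OPEN}_{\min}$, which is expanded: it is moved from OPEN to CLOSED and all its successors are generated in the given order. A newly encountered state is inserted into OPEN; a strictly smaller tentative $g$ updates an existing OPEN entry's $g$ and parent but keeps its first-insertion timestamp; equal- and higher-cost duplicates are discarded. (With consistent $h$ an expanded state has $g=g^*$ and is never reopened.) **Tie-breakers.** A tie-breaker is an arbitrary, possibly randomized, history- and instance-dependent rule for choosing the non-goal of $\mathrm{OPEN}_{\min}$ to expand. $E_{\alpha,\tau}(I;\rho)$ is the set of non-goal states expanded by the run with weight $\alpha$, tie-breaker $\tau$ and random outcome $\rho$; the expansion count is its cardinality. *)

theory Defs
  imports "Graph_Theory.Graph_Theory"
begin

section \<open>Search instances\<close>

record 'v search_instance =
  state_graph :: "'v pair_pre_digraph"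
  cost :: "'v \<times> 'v \<Rightarrow> real"
  start :: 'v
  goals :: "'v set"
  heur :: "'v \<Rightarrow> real"
  succs :: "'v \<Rightarrow> 'v list"  \<comment> \<open>successors in generation order\<close>

locale search_instance = pair_fin_digraph "state_graph I"
  for I :: "'v search_instance" +
  assumes cost_nonneg: "e \<in> parcs (state_graph I) \<Longrightarrow> 0 \<le> cost I e"
    and start_in_verts: "start I \<in> pverts (state_graph I)"
    and goals_subset: "goals I \<subseteq> pverts (state_graph I)"
    and start_not_goal: "start I \<notin> goals I"
    and set_succs: "u \<in> pverts (state_graph I) \<Longrightarrow> set (succs I u) = {v. (u, v) \<in> parcs (state_graph I)}"
    and distinct_succs: "u \<in> pverts (state_graph I) \<Longrightarrow> distinct (succs I u)"

text \<open>
  \<^const>\<open>wf_digraph.\<mu>\<close> is the infimum of the costs of all walks between two vertices; it is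
  \<open>\<infinity>\<close> if there is none, and attained otherwise, since the graph is finite and costs are
  nonnegative.
\<close>

definition dist_between :: "'v search_instance \<Rightarrow> 'v \<Rightarrow> 'v \<Rightarrow> ereal" where
  "dist_between I u v = wf_digraph.\<mu> (with_proj (state_graph I)) (cost I) u v"

definition gstar :: "'v search_instance \<Rightarrow> 'v \<Rightarrow> ereal" where
  "gstar I v = dist_between I (start I) v"

definition hstar :: "'v search_instance \<Rightarrow> 'v \<Rightarrow> ereal" where
  "hstar I v = (INF t \<in> goals I. dist_between I v t)"

definition Cstar :: "'v search_instance \<Rightarrow> ereal" where
  "Cstar I = hstar I (start I)"

definition solvable :: "'v search_instance \<Rightarrow> bool" where
  "solvable I \<longleftrightarrow> Cstar I < \<infinity>"

definition consistent :: "'v search_instance \<Rightarrow> bool" where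
  "consistent I \<longleftrightarrow>
     (\<forall>(u, v) \<in> parcs (state_graph I). heur I u \<le> cost I (u, v) + heur I v)"


section \<open>Weighted A*\<close>

record 'v entry =
  gval :: real
  parent :: "'v option"
  stamp :: nat
  is_goal :: bool

text \<open>\<open>clock\<close> is the timestamp that the next newly inserted state will get.\<close>

record 'v search_state =
  OPEN :: "'v \<rightharpoonup> 'v entry"
  CLOSED :: "'v \<rightharpoonup> 'v entry"
  clock :: nat

definition init_state :: "'v search_instance \<Rightarrow> 'v search_state" where
  "init_state I =
     \<lparr> OPEN = [start I \<mapsto> \<lparr> gval = 0, parent = None, stamp = 0, is_goal = (start I \<in> goals I) \<rparr>],
       CLOSED = Map.empty, clock = 1 \<rparr>"

definition f_val :: "'v search_instance \<Rightarrow> real \<Rightarrow> 'v search_state \<Rightarrow> 'v \<Rightarrow> real" where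
  "f_val I \<alpha> \<sigma> v = gval (the (OPEN \<sigma> v)) + \<alpha> * heur I v"

definition OPEN_min :: "'v search_instance \<Rightarrow> real \<Rightarrow> 'v search_state \<Rightarrow> 'v set" where
  "OPEN_min I \<alpha> \<sigma> = {v. is_arg_min (f_val I \<alpha> \<sigma>) (\<lambda>w. w \<in> dom (OPEN \<sigma>)) v}"

text \<open>
  Generate the successor \<open>v\<close> of the state \<open>u\<close>, which is expanded with cost \<open>gu\<close>. A strictly
  cheaper path to a closed state reopens it; under a consistent heuristic this never happens.
\<close>

definition generate ::
  "'v search_instance \<Rightarrow> 'v \<Rightarrow> real \<Rightarrow> 'v \<Rightarrow> 'v search_state \<Rightarrow> 'v search_state" where
  "generate I u gu v \<sigma> =
     (let g = gu + cost I (u, v) in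
      case (CLOSED \<sigma> ++ OPEN \<sigma>) v of
        None \<Rightarrow>
          \<sigma>\<lparr> OPEN := (OPEN \<sigma>)(v \<mapsto> \<lparr> gval = g, parent = Some u, stamp = clock \<sigma>,
                                     is_goal = (v \<in> goals I) \<rparr>),
             clock := Suc (clock \<sigma>) \<rparr>
      | Some e \<Rightarrow>
          if g < gval e
          then \<sigma>\<lparr> OPEN := (OPEN \<sigma>)(v \<mapsto> e\<lparr> gval := g, parent := Some u \<rparr>),
                  CLOSED := (CLOSED \<sigma>)(v := None) \<rparr>
          else \<sigma>)"

definition expand :: "'v search_instance \<Rightarrow> 'v \<Rightarrow> 'v search_state \<Rightarrow> 'v search_state" where
  "expand I u \<sigma> =
     (let e = the (OPEN \<sigma> u) in
      fold (generate I u (gval e)) (succs I u)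
        (\<sigma>\<lparr> OPEN := (OPEN \<sigma>)(u := None), CLOSED := (CLOSED \<sigma>)(u \<mapsto> e) \<rparr>))"

text \<open>
  A history lists the search states at all selection points so far, the current one first.
  Given a random outcome, the instance, the history and the set of candidates, a tie-breaker
  picks one of the candidates. The only constraint is that the pick is a candidate.
\<close>

type_synonym 'v history = "'v search_state list"

type_synonym ('r, 'v) tie_breaker =
  "'r \<Rightarrow> 'v search_instance \<Rightarrow> 'v history \<Rightarrow> 'v set \<Rightarrow> 'v"

definition valid_tie_breaker :: "('r, 'v) tie_breaker \<Rightarrow> bool" where
  "valid_tie_breaker \<tau> \<longleftrightarrow> (\<forall>\<rho> I H C. finite C \<and> C \<noteq> {} \<longrightarrow> \<tau> \<rho> I H C \<in> C)"

text \<open>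
  The state to be expanded at the current selection point; \<^const>\<open>None\<close> if the search has ended,
  either because a goal is selected or because OPEN is empty.
\<close>

definition next_expansion ::
  "'v search_instance \<Rightarrow> real \<Rightarrow> ('r, 'v) tie_breaker \<Rightarrow> 'r \<Rightarrow> 'v history \<Rightarrow> 'v option" where
  "next_expansion I \<alpha> \<tau> \<rho> H =
     (let C = OPEN_min I \<alpha> (hd H) in
      if C = {} \<or> C \<inter> goals I \<noteq> {} then None else Some (\<tau> \<rho> I H C))"

text \<open>The history after \<open>n\<close> steps of the run; it stays constant once the search has ended.\<close>

fun run ::
  "'v search_instance \<Rightarrow> real \<Rightarrow> ('r, 'v) tie_breaker \<Rightarrow> 'r \<Rightarrow> nat \<Rightarrow> 'v history" where
  "run I \<alpha> \<tau> \<rho> 0 = [init_state I]"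
| "run I \<alpha> \<tau> \<rho> (Suc n) =
     (let H = run I \<alpha> \<tau> \<rho> n in
      case next_expansion I \<alpha> \<tau> \<rho> H of
        None \<Rightarrow> H
      | Some u \<Rightarrow> expand I u (hd H) # H)"

definition expanded ::
  "'v search_instance \<Rightarrow> real \<Rightarrow> ('r, 'v) tie_breaker \<Rightarrow> 'r \<Rightarrow> 'v set" where
  "expanded I \<alpha> \<tau> \<rho> =
     {v. v \<notin> goals I \<and> (\<exists>n. next_expansion I \<alpha> \<tau> \<rho> (run I \<alpha> \<tau> \<rho> n) = Some v)}"

definition expansion_count ::
  "'v search_instance \<Rightarrow> real \<Rightarrow> ('r, 'v) tie_breaker \<Rightarrow> 'r \<Rightarrow> nat" where
  "expansion_count I \<alpha> \<tau> \<rho> = card (expanded I \<alpha> \<tau> \<rho>)"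

definition S_less :: "'v search_instance \<Rightarrow> real \<Rightarrow> 'v set" where
  "S_less I \<alpha> =
     {v \<in> pverts (state_graph I) - goals I. gstar I v + ereal (\<alpha> * heur I v) < Cstar I}"

end

theory Submission
  imports Defs
begin

text \<open>
  Along a walk from the start, as long as no open state is met, the states are closed with
  \<open>g\<close>-values at most the cost of the walk. So every walk \<open>p\<close> to a state that is not closed meets an
  open state \<open>w\<close> with \<open>g(w) + \<beta> h(w) \<le> c(p) + \<beta> h(v)\<close>, for each \<open>0 \<le> \<beta> \<le> 1\<close>, by consistency.

  With \<open>\<beta> = \<alpha>\<close>, a selected state has an optimal \<open>g\<close>-value; hence nothing is reopened and the search
  ends. Applied to a walk to a state of \<open>S\<^sub><\<close>, it shows that this state is closed in the end, as
  otherwise the selected goal would be cheaper than \<open>C\<^sup>*\<close>.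

  With \<open>\<beta> = 1\<close> and an optimal solution, there always is an open \<open>w\<close> with \<open>g(w) + h(w) \<le> C\<^sup>*\<close>. If \<open>w\<close>
  is no goal, then \<open>h(w) > 0\<close> and \<open>\<alpha> < 1\<close> give \<open>f\<^sub>\<alpha>(w) < C\<^sup>*\<close>; if \<open>w\<close> is a goal, goal preference
  rules out that a non-goal with \<open>f\<^sub>\<alpha> \<ge> C\<^sup>*\<close> is selected. So only states with \<open>f\<^sub>\<alpha> < C\<^sup>*\<close> are expanded.
\<close>

locale weighted_astar = search_instance I for I :: "'v search_instance" +
  fixes \<alpha> :: real
  assumes heur_consistent: "consistent I"
    and heur_goal: "t \<in> goals I \<Longrightarrow> heur I t = 0"
    and heur_pos: "v \<in> pverts (state_graph I) \<Longrightarrow> v \<notin> goals I \<Longrightarrow> 0 < heur I v"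
    and alpha_nonneg: "0 \<le> \<alpha>"
    and alpha_less_one: "\<alpha> < 1"
begin

section \<open>Walks, attained distances, and consistency along an arc\<close>

abbreviation walk_cost :: "('v \<times> 'v) list \<Rightarrow> real" where
  "walk_cost \<equiv> awalk_cost (cost I)"

lemma awalk_snoc:
  assumes "awalk s p u" and "(u, v) \<in> parcs (state_graph I)"
  shows "awalk s (p @ [(u, v)]) v"
  using assms in_arcsD1 in_arcsD2 by (auto simp: awalk_simps intro!: awalk_appendI)

text \<open>With nonnegative costs, cycles never pay off, so the infimum over all walks is a minimum
  over simple paths.\<close>

lemma min_cost_walk_exists:
  assumes "dist_between I s v < \<infinity>"
  obtains p where "awalk s p v" "dist_between I s v = walk_cost p"
proof -
  have "s \<rightarrow>\<^sup>*\<^bsub>state_graph I\<^esub> v"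
    using assms unfolding dist_between_def by (rule iffD1[OF \<mu>_reach_conv])
  then have "\<exists>p. apath s p v \<and> dist_between I s v = walk_cost p"
    unfolding dist_between_def by (rule min_cost_awalk) (rule cost_nonneg)
  then show thesis
    using that by (auto simp: apath_def)
qed

lemma heur_arc: "(u, v) \<in> parcs (state_graph I) \<Longrightarrow> heur I u \<le> cost I (u, v) + heur I v"
  using heur_consistent unfolding consistent_def by auto

section \<open>The search invariant\<close>

text \<open>\<open>X\<close> holds the arcs out of closed states that have yet to be generated.\<close>

definition invariant ::
  "('v \<times> 'v) set \<Rightarrow> ('v \<rightharpoonup> 'v entry) \<Rightarrow> ('v \<rightharpoonup> 'v entry) \<Rightarrow> bool" where
  "invariant X Op Cl \<longleftrightarrow>
     dom Op \<inter> dom Cl = {} \<and>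
     (\<exists>e. (Cl ++ Op) (start I) = Some e \<and> gval e \<le> 0) \<and>
     (\<forall>v e. (Cl ++ Op) v = Some e \<longrightarrow> (\<exists>p. awalk (start I) p v \<and> walk_cost p = gval e)) \<and>
     (\<forall>v e p. Cl v = Some e \<longrightarrow> awalk (start I) p v \<longrightarrow> gval e \<le> walk_cost p) \<and>
     (\<forall>u v e. Cl u = Some e \<longrightarrow> (u, v) \<in> parcs (state_graph I) - X \<longrightarrow>
        (\<exists>e'. (Cl ++ Op) v = Some e' \<and> gval e' \<le> gval e + cost I (u, v)))"

lemma
  assumes "invariant X Op Cl"
  shows invariant_disjoint: "Op v = Some e \<Longrightarrow> Cl v = None"
    and invariant_start: "\<exists>e. (Cl ++ Op) (start I) = Some e \<and> gval e \<le> 0"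
    and invariant_walk:
      "(Cl ++ Op) v = Some e \<Longrightarrow> \<exists>p. awalk (start I) p v \<and> walk_cost p = gval e"
    and invariant_closed:
      "Cl v = Some e \<Longrightarrow> awalk (start I) p v \<Longrightarrow> gval e \<le> walk_cost p"
    and invariant_arc:
      "Cl u = Some e \<Longrightarrow> (u, v) \<in> parcs (state_graph I) \<Longrightarrow> (u, v) \<notin> X \<Longrightarrow>
        \<exists>e'. (Cl ++ Op) v = Some e' \<and> gval e' \<le> gval e + cost I (u, v)"
proof -
  note inv = assms[unfolded invariant_def]
  show "Op v = Some e \<Longrightarrow> Cl v = None" using inv by blast
  show "\<exists>e. (Cl ++ Op) (start I) = Some e \<and> gval e \<le> 0" using inv by simp
  show "(Cl ++ Op) v = Some e \<Longrightarrow> \<exists>p. awalk (start I) p v \<and> walk_cost p = gval e" using inv by simp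
  show "Cl v = Some e \<Longrightarrow> awalk (start I) p v \<Longrightarrow> gval e \<le> walk_cost p" using inv by simp
  show "Cl u = Some e \<Longrightarrow> (u, v) \<in> parcs (state_graph I) \<Longrightarrow> (u, v) \<notin> X \<Longrightarrow>
      \<exists>e'. (Cl ++ Op) v = Some e' \<and> gval e' \<le> gval e + cost I (u, v)" using inv by simp
qed

lemma invariant_open_walk:
  assumes "invariant X Op Cl" and "Op v = Some e"
  shows "\<exists>p. awalk (start I) p v \<and> walk_cost p = gval e"
  using invariant_walk[OF assms(1), of v e] assms(2) by simp

lemma invariant_dom:
  assumes "invariant X Op Cl"
  shows "dom Op \<subseteq> pverts (state_graph I)" and "dom Cl \<subseteq> pverts (state_graph I)"
proof -
  have "dom (Cl ++ Op) \<subseteq> pverts (state_graph I)"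
  proof
    fix v assume "v \<in> dom (Cl ++ Op)"
    then obtain e where "(Cl ++ Op) v = Some e" by (meson domD)
    then show "v \<in> pverts (state_graph I)"
      using invariant_walk[OF assms] awalk_last_in_verts by meson
  qed
  then show "dom Op \<subseteq> pverts (state_graph I)" and "dom Cl \<subseteq> pverts (state_graph I)"
    by auto
qed

lemma invariant_init: "invariant {} (OPEN (init_state I)) (CLOSED (init_state I))"
proof -
  have "awalk (start I) [] (start I)"
    using start_in_verts by (simp add: awalk_Nil_iff)
  then show ?thesis
    unfolding invariant_def init_state_def by (auto intro!: exI[of _ "[]"])
qed

section \<open>Preservation of the invariant under generation\<close>

text \<open>Covers a first insertion, where \<open>le\<close> is vacuous, as well as a decrease of
  \<open>g\<close>. Known values only go down, so upper bounds on them survive; the arc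
  \<open>(u, v)\<close> is then settled and leaves \<open>X\<close>.\<close>

lemma invariant_insert_open:
  assumes inv: "invariant X Op Cl"
    and u: "Cl u = Some e" and v: "Cl v = None"
    and arc: "(u, v) \<in> parcs (state_graph I)"
    and n: "gval n = gval e + cost I (u, v)"
    and le: "\<And>e'. Op v = Some e' \<Longrightarrow> gval n \<le> gval e'"
  shows "invariant (X - {(u, v)}) (Op(v \<mapsto> n)) Cl"
proof -
  obtain p where "awalk (start I) p u" "walk_cost p = gval e"
    using invariant_walk[OF inv, of u e] u invariant_disjoint[OF inv, of u]
    by (cases "Op u") (auto simp: map_add_Some_iff)
  then have walk: "\<exists>p. awalk (start I) p v \<and> walk_cost p = gval n"
    using awalk_snoc[OF _ arc] n by (intro exI[of _ "p @ [(u, v)]"]) auto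
  have mono: "\<exists>e''. (Cl ++ Op(v \<mapsto> n)) x = Some e'' \<and> gval e'' \<le> r"
    if "\<exists>e'. (Cl ++ Op) x = Some e' \<and> gval e' \<le> r" for x r
    using that le v by (cases "x = v") (fastforce simp: map_add_Some_iff)+
  show ?thesis
    unfolding invariant_def
  proof (intro conjI allI impI)
    show "dom (Op(v \<mapsto> n)) \<inter> dom Cl = {}"
      using inv v unfolding invariant_def by auto
    show "\<exists>e. (Cl ++ Op(v \<mapsto> n)) (start I) = Some e \<and> gval e \<le> 0"
      using mono[OF invariant_start[OF inv]] .
    show "\<exists>p. awalk (start I) p x \<and> walk_cost p = gval e'"
      if "(Cl ++ Op(v \<mapsto> n)) x = Some e'" for x e'
      using that walk invariant_walk[OF inv, of x e'] by (cases "x = v") auto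
    show "gval e' \<le> walk_cost p" if "Cl x = Some e'" "awalk (start I) p x" for x e' p
      using invariant_closed[OF inv that] .
    show "\<exists>e''. (Cl ++ Op(v \<mapsto> n)) y = Some e'' \<and> gval e'' \<le> gval e' + cost I (x, y)"
      if "Cl x = Some e'" "(x, y) \<in> parcs (state_graph I) - (X - {(u, v)})" for x y e'
    proof (cases "(x, y) = (u, v)")
      case True
      then show ?thesis using that u n by auto
    next
      case False
      then show ?thesis using that by (intro mono invariant_arc[OF inv that(1)]) auto
    qed
  qed
qed

text \<open>Closed \<open>g\<close>-values are optimal and the tentative value is the cost of a real
  walk. So it cannot undercut a closed entry, and nothing is reopened.\<close>

lemma invariant_generate:
  assumes inv: "invariant X (OPEN \<sigma>) (CLOSED \<sigma>)"
    and u: "CLOSED \<sigma> u = Some e"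
    and arc: "(u, v) \<in> parcs (state_graph I)"
  shows "invariant (X - {(u, v)}) (OPEN (generate I u (gval e) v \<sigma>)) (CLOSED \<sigma>) \<and>
    CLOSED (generate I u (gval e) v \<sigma>) = CLOSED \<sigma>"
proof (cases "(CLOSED \<sigma> ++ OPEN \<sigma>) v")
  case None
  then have "OPEN \<sigma> v = None" "CLOSED \<sigma> v = None" by auto
  then show ?thesis
    unfolding generate_def Let_def None using invariant_insert_open[OF inv u _ arc] by simp
next
  case (Some e')
  show ?thesis
  proof (cases "gval e + cost I (u, v) < gval e'")
    case True
    have "CLOSED \<sigma> v = None"
    proof (rule ccontr)
      assume "CLOSED \<sigma> v \<noteq> None"
      then have "CLOSED \<sigma> v = Some e'"
        using Some invariant_disjoint[OF inv, of v] by (auto simp: map_add_Some_iff)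
      moreover obtain p where p: "awalk (start I) p u" "walk_cost p = gval e"
        using invariant_walk[OF inv, of u e] u invariant_disjoint[OF inv, of u]
        by (cases "OPEN \<sigma> u") (auto simp: map_add_Some_iff)
      ultimately have "gval e' \<le> walk_cost (p @ [(u, v)])"
        using invariant_closed[OF inv _ awalk_snoc[OF p(1) arc]] by simp
      then show False
        using True p(2) by simp
    qed
    \<comment> \<open>The deletion from CLOSED performed by \<open>generate\<close> therefore has no
      effect.\<close>
    moreover from this have "(CLOSED \<sigma>)(v := None) = CLOSED \<sigma>" by auto
    moreover have "OPEN \<sigma> v = Some e'"
      using Some \<open>CLOSED \<sigma> v = None\<close> by (auto simp: map_add_Some_iff)
    ultimately show ?thesis
      unfolding generate_def Let_def Some using True invariant_insert_open[OF inv u _ arc] by simp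
  next
    case False
    \<comment> \<open>The duplicate is discarded: the entry \<open>e'\<close> on record already
      settles the arc \<open>(u, v)\<close>.\<close>
    have "invariant (X - {(u, v)}) (OPEN \<sigma>) (CLOSED \<sigma>)"
      unfolding invariant_def
    proof (intro conjI allI impI)
      show "dom (OPEN \<sigma>) \<inter> dom (CLOSED \<sigma>) = {}"
        using inv by (simp add: invariant_def)
      show "\<exists>e''. (CLOSED \<sigma> ++ OPEN \<sigma>) y = Some e'' \<and> gval e'' \<le> gval a + cost I (x, y)"
        if "CLOSED \<sigma> x = Some a" "(x, y) \<in> parcs (state_graph I) - (X - {(u, v)})" for x y a
      proof (cases "(x, y) = (u, v)")
        case True
        then show ?thesis using that u Some False by (intro exI[of _ e']) simp
      next
        case False
        then show ?thesis using that by (intro invariant_arc[OF inv]) auto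
      qed
    qed (fact invariant_start[OF inv] invariant_walk[OF inv] invariant_closed[OF inv])+
    then show ?thesis
      unfolding generate_def Let_def Some using False by simp
  qed
qed

lemma invariant_fold_generate:
  assumes "invariant X (OPEN \<sigma>) (CLOSED \<sigma>)"
    and "CLOSED \<sigma> u = Some e"
    and "{u} \<times> set vs \<subseteq> parcs (state_graph I)"
  shows "invariant (X - {u} \<times> set vs) (OPEN (fold (generate I u (gval e)) vs \<sigma>)) (CLOSED \<sigma>) \<and>
    CLOSED (fold (generate I u (gval e)) vs \<sigma>) = CLOSED \<sigma>"
  using assms
proof (induction vs arbitrary: X \<sigma>)
  case Nil
  then show ?case by simp
next
  case (Cons v vs)
  let ?\<sigma> = "generate I u (gval e) v \<sigma>"
  have *: "invariant (X - {(u, v)}) (OPEN ?\<sigma>) (CLOSED \<sigma>)" "CLOSED ?\<sigma> = CLOSED \<sigma>"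
    using invariant_generate[OF Cons.prems(1,2)] Cons.prems(3) by auto
  have "X - {u} \<times> set (v # vs) = X - {(u, v)} - {u} \<times> set vs" by auto
  then show ?case
    using Cons.IH[of "X - {(u, v)}" ?\<sigma>] * Cons.prems by simp
qed

section \<open>Crossing the frontier, and optimality of selected states\<close>

text \<open>Induction along the walk. The successor of a closed state is closed or open, since no
  arc is pending (\<open>X\<close> is empty); once an open \<open>w\<close> has been met,
  consistency carries its bound over each further arc.\<close>

lemma frontier:
  assumes inv: "invariant {} Op Cl" and p: "awalk (start I) p v" and \<beta>: "0 \<le> \<beta>" "\<beta> \<le> 1"
  shows "(\<exists>e. Cl v = Some e \<and> gval e \<le> walk_cost p) \<or>
    (\<exists>w e. Op w = Some e \<and> gval e + \<beta> * heur I w \<le> walk_cost p + \<beta> * heur I v)"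
  using p
proof (induction p arbitrary: v rule: rev_induct)
  case Nil
  then have "v = start I" by (simp add: awalk_Nil_iff)
  then show ?case
    using invariant_start[OF inv] by (fastforce simp: map_add_Some_iff)
next
  case (snoc a p)
  then obtain u where u: "awalk (start I) p u" and a: "a = (u, v)"
    and arc: "(u, v) \<in> parcs (state_graph I)"
    by (cases a) (auto simp: awalk_simps)
  from snoc.IH[OF u] show ?case
  proof (elim disjE exE conjE)
    fix e assume "Cl u = Some e" "gval e \<le> walk_cost p"
    moreover from invariant_arc[OF inv this(1) arc] obtain e' where
      "(Cl ++ Op) v = Some e'" "gval e' \<le> gval e + cost I (u, v)" by (metis empty_iff)
    ultimately have "(Cl ++ Op) v = Some e'" "gval e' \<le> walk_cost p + cost I (u, v)" by auto
    \<comment> \<open>If \<open>v\<close> is open, it serves as \<open>w\<close> itself.\<close>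
    then show ?thesis
      using a by (fastforce simp: map_add_Some_iff)
  next
    fix w e assume w: "Op w = Some e" "gval e + \<beta> * heur I w \<le> walk_cost p + \<beta> * heur I u"
    \<comment> \<open>Scaling keeps consistency: as costs are nonnegative and
      \<open>\<beta> \<le> 1\<close>, \<open>\<beta> * heur I\<close> also drops by at most the arc
      cost.\<close>
    have "\<beta> * heur I u \<le> \<beta> * cost I (u, v) + \<beta> * heur I v"
      using heur_arc[OF arc] \<beta> by (metis distrib_left mult_left_mono)
    also have "\<beta> * cost I (u, v) \<le> cost I (u, v)"
      using cost_nonneg[OF arc] \<beta> by (simp add: mult_left_le_one_le)
    finally show ?thesis
      using w a by fastforce
  qed
qed

text \<open>\<open>u\<close> is open, hence not closed, so \<open>frontier\<close> with
  \<open>\<beta> = \<alpha>\<close> yields an open \<open>w\<close>. Minimality compares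
  \<open>u\<close> with \<open>w\<close>, and \<open>\<alpha> * heur I u\<close> cancels.\<close>

lemma selected_optimal:
  assumes inv: "invariant {} (OPEN \<sigma>) (CLOSED \<sigma>)"
    and u: "u \<in> OPEN_min I \<alpha> \<sigma>"
    and e: "OPEN \<sigma> u = Some e" and p: "awalk (start I) p u"
  shows "gval e \<le> walk_cost p"
proof -
  obtain w e' where w: "OPEN \<sigma> w = Some e'"
    "gval e' + \<alpha> * heur I w \<le> walk_cost p + \<alpha> * heur I u"
    using frontier[OF inv p alpha_nonneg] alpha_less_one invariant_disjoint[OF inv e] by auto
  have "f_val I \<alpha> \<sigma> u \<le> f_val I \<alpha> \<sigma> w"
    using u w unfolding OPEN_min_def is_arg_min_def by fastforce
  then show ?thesis
    using w e by (simp add: f_val_def)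
qed

text \<open>The arcs out of \<open>u\<close> form the pending set, which generation empties. The
  growth of CLOSED by exactly one new state is what later bounds the length of the run.\<close>

lemma invariant_expand:
  assumes inv: "invariant {} (OPEN \<sigma>) (CLOSED \<sigma>)"
    and u: "u \<in> OPEN_min I \<alpha> \<sigma>"
  shows "invariant {} (OPEN (expand I u \<sigma>)) (CLOSED (expand I u \<sigma>)) \<and>
    dom (CLOSED (expand I u \<sigma>)) = insert u (dom (CLOSED \<sigma>)) \<and> u \<notin> dom (CLOSED \<sigma>)"
proof -
  obtain e where e: "OPEN \<sigma> u = Some e"
    using u unfolding OPEN_min_def is_arg_min_def by auto
  have u_not_closed: "CLOSED \<sigma> u = None"
    using invariant_disjoint[OF inv e] .
  have u_vert: "u \<in> pverts (state_graph I)"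
    using invariant_dom[OF inv] e by auto
  let ?Op = "(OPEN \<sigma>)(u := None)" and ?Cl = "(CLOSED \<sigma>)(u \<mapsto> e)"
  have succs_arcs: "{u} \<times> set (succs I u) \<subseteq> parcs (state_graph I)"
    using set_succs[OF u_vert] by auto
  \<comment> \<open>Moving the entry of \<open>u\<close> from OPEN to CLOSED keeps the combined map,
    so the clauses on that map alone carry over.\<close>
  have same: "?Cl ++ ?Op = CLOSED \<sigma> ++ OPEN \<sigma>"
    using e by (auto simp: map_add_def fun_eq_iff split: option.split)
  have "invariant ({u} \<times> set (succs I u)) ?Op ?Cl"
    unfolding invariant_def same
  proof (intro conjI allI impI)
    show "dom ?Op \<inter> dom ?Cl = {}"
      using inv unfolding invariant_def by auto
    show "\<exists>e. (CLOSED \<sigma> ++ OPEN \<sigma>) (start I) = Some e \<and> gval e \<le> 0"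
      using invariant_start[OF inv] .
    show "\<exists>p. awalk (start I) p x \<and> walk_cost p = gval e'"
      if "(CLOSED \<sigma> ++ OPEN \<sigma>) x = Some e'" for x e'
      using invariant_walk[OF inv that] .
    show "gval e' \<le> walk_cost p" if "?Cl x = Some e'" "awalk (start I) p x" for x e' p
      using that selected_optimal[OF inv u e] invariant_closed[OF inv]
      by (cases "x = u") auto
    show "\<exists>e''. (CLOSED \<sigma> ++ OPEN \<sigma>) y = Some e'' \<and> gval e'' \<le> gval e' + cost I (x, y)"
      if "?Cl x = Some e'" "(x, y) \<in> parcs (state_graph I) - {u} \<times> set (succs I u)" for x y e'
      using that set_succs[OF u_vert] invariant_arc[OF inv, of x e' y] by (cases "x = u") auto
  qed
  \<comment> \<open>The difference is empty; it is spelled out to fit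
    \<open>invariant_fold_generate\<close>.\<close>
  then have "invariant ({u} \<times> set (succs I u) - {u} \<times> set (succs I u))
      (OPEN (expand I u \<sigma>)) ?Cl \<and> CLOSED (expand I u \<sigma>) = ?Cl"
    using invariant_fold_generate[of "{u} \<times> set (succs I u)" "\<sigma>\<lparr>OPEN := ?Op, CLOSED := ?Cl\<rparr>" u e "succs I u"]
      succs_arcs e
    by (simp add: expand_def)
  then show ?thesis
    using u_not_closed by auto
qed

section \<open>Minimal open states\<close>

lemma finite_OPEN: "invariant X (OPEN \<sigma>) (CLOSED \<sigma>) \<Longrightarrow> finite (dom (OPEN \<sigma>))"
  by (rule finite_subset[OF invariant_dom(1) pair_finite_verts])

lemma OPEN_min_subset: "OPEN_min I \<alpha> \<sigma> \<subseteq> dom (OPEN \<sigma>)"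
  unfolding OPEN_min_def is_arg_min_def by auto

lemma OPEN_min_nonempty:
  assumes "invariant X (OPEN \<sigma>) (CLOSED \<sigma>)" and "OPEN \<sigma> w = Some e"
  shows "OPEN_min I \<alpha> \<sigma> \<noteq> {}"
proof -
  have "dom (OPEN \<sigma>) \<noteq> {}" using assms(2) by auto
  from ex_is_arg_min_if_finite[OF finite_OPEN[OF assms(1)] this] show ?thesis
    unfolding OPEN_min_def by auto
qed

lemma OPEN_min_le:
  assumes "u \<in> OPEN_min I \<alpha> \<sigma>" and "OPEN \<sigma> w = Some e"
  shows "f_val I \<alpha> \<sigma> u \<le> gval e + \<alpha> * heur I w"
proof -
  have "\<not> f_val I \<alpha> \<sigma> w < f_val I \<alpha> \<sigma> u"
    using assms unfolding OPEN_min_def is_arg_min_def by auto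
  then show ?thesis
    using assms by (simp add: f_val_def)
qed

section \<open>Walks against \<open>gstar\<close> and \<open>Cstar\<close>\<close>

lemma gstar_le:
  assumes "awalk (start I) p v"
  shows "gstar I v \<le> walk_cost p"
  using min_cost_le_walk_cost[OF assms] unfolding gstar_def dist_between_def .

lemma Cstar_le:
  assumes "awalk (start I) p t" and "t \<in> goals I"
  shows "Cstar I \<le> walk_cost p"
proof -
  have "Cstar I \<le> gstar I t"
    unfolding Cstar_def hstar_def gstar_def using assms(2) by (rule INF_lower)
  then show ?thesis
    using gstar_le[OF assms(1)] by (rule order_trans)
qed

text \<open>Passes from extended reals to a walk of real cost: the strict bound forces
  \<open>gstar I v < \<infinity>\<close>, hence the distance is attained.\<close>

lemma gstar_less_walk:
  assumes "gstar I v + ereal r < x"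
  shows "\<exists>p. awalk (start I) p v \<and> ereal (walk_cost p + r) < x"
proof -
  have "gstar I v < \<infinity>" using assms by (cases "gstar I v") auto
  then obtain p where "awalk (start I) p v" "gstar I v = walk_cost p"
    unfolding gstar_def by (rule min_cost_walk_exists)
  then show ?thesis
    using assms by (intro exI[of _ p]) auto
qed

lemma Cstar_attained:
  assumes "solvable I"
  obtains t p where "t \<in> goals I" "awalk (start I) p t" "Cstar I = walk_cost p"
proof -
  \<comment> \<open>An infimum over no goals would be infinite, against solvability.\<close>
  have ne: "goals I \<noteq> {}"
    using assms unfolding solvable_def Cstar_def hstar_def by (auto simp: top_ereal_def)
  have fin: "finite (goals I)"
    by (rule finite_subset[OF goals_subset pair_finite_verts])
  obtain t where t: "t \<in> goals I" "Cstar I = dist_between I (start I) t"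
    using finite_INF_in[OF fin ne, of "dist_between I (start I)"]
    unfolding Cstar_def hstar_def by auto
  then have "dist_between I (start I) t < \<infinity>"
    using assms unfolding solvable_def by simp
  then obtain p where "awalk (start I) p t" "dist_between I (start I) t = walk_cost p"
    by (rule min_cost_walk_exists)
  then show thesis
    using that t by simp
qed

section \<open>Selected and closed states against \<open>Cstar\<close>\<close>

lemma selected_less_Cstar:
  assumes "solvable I"
    and inv: "invariant {} (OPEN \<sigma>) (CLOSED \<sigma>)"
    and closed: "dom (CLOSED \<sigma>) \<inter> goals I = {}"
    and u: "u \<in> OPEN_min I \<alpha> \<sigma>" and no_goal: "OPEN_min I \<alpha> \<sigma> \<inter> goals I = {}"
  shows "u \<in> S_less I \<alpha>"
proof -
  obtain t p where t: "t \<in> goals I" and p: "awalk (start I) p t" and C: "Cstar I = walk_cost p"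
    using Cstar_attained[OF assms(1)] .
  have "CLOSED \<sigma> t = None"
    using closed t by auto
  \<comment> \<open>The goal \<open>t\<close> is not closed, so the optimal walk yields an open
    \<open>w\<close>. With \<open>\<beta> = 1\<close> and \<open>heur I t = 0\<close>, its full
    \<open>g + h\<close> is at most \<open>Cstar I\<close>.\<close>
  then obtain w e where w: "OPEN \<sigma> w = Some e" and "gval e + 1 * heur I w \<le> walk_cost p + 1 * heur I t"
    using frontier[OF inv p, of 1] by auto
  then have g: "gval e + heur I w \<le> walk_cost p"
    using heur_goal[OF t] by simp
  have "f_val I \<alpha> \<sigma> u < walk_cost p"
  proof (cases "w \<in> goals I")
    case True
    \<comment> \<open>A goal \<open>w\<close> by itself gives only \<open>f \<le> Cstar I\<close>.
      Its absence from \<open>OPEN_min\<close> supplies a strictly better open \<open>x\<close>,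
      which makes the bound strict.\<close>
    then have "w \<notin> OPEN_min I \<alpha> \<sigma>"
      using no_goal by auto
    then obtain x e' where x: "OPEN \<sigma> x = Some e'" "f_val I \<alpha> \<sigma> x < f_val I \<alpha> \<sigma> w"
      using w unfolding OPEN_min_def is_arg_min_def by auto
    have "f_val I \<alpha> \<sigma> u \<le> f_val I \<alpha> \<sigma> x"
      using OPEN_min_le[OF u x(1)] x(1) by (simp add: f_val_def)
    also have "\<dots> < gval e"
      using x(2) w heur_goal[OF True] by (simp add: f_val_def)
    also have "\<dots> \<le> walk_cost p"
      using g heur_goal[OF True] by simp
    finally show ?thesis .
  next
    case False
    have "w \<in> pverts (state_graph I)"
      using invariant_dom(1)[OF inv] w by auto
    \<comment> \<open>The strict gain comes from \<open>heur I w > 0\<close> and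
      \<open>\<alpha> < 1\<close>.\<close>
    then have "\<alpha> * heur I w < heur I w"
      using heur_pos False alpha_less_one by simp
    then show ?thesis
      using OPEN_min_le[OF u w] g by simp
  qed
  moreover obtain e' where e': "OPEN \<sigma> u = Some e'"
    using u OPEN_min_subset by fastforce
  moreover have "gstar I u \<le> gval e'"
  proof -
    obtain q where "awalk (start I) q u" "walk_cost q = gval e'"
      using invariant_open_walk[OF inv e'] by blast
    then show ?thesis using gstar_le by metis
  qed
  ultimately have "gstar I u \<le> gval e'" "gval e' + \<alpha> * heur I u < walk_cost p"
    by (simp_all add: f_val_def)
  then have "gstar I u + ereal (\<alpha> * heur I u) < Cstar I"
    unfolding C by (cases "gstar I u") auto
  moreover have "u \<in> pverts (state_graph I)"
    using invariant_dom(1)[OF inv] e' by auto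
  moreover have "u \<notin> goals I"
    using u no_goal by auto
  ultimately show ?thesis
    unfolding S_less_def by auto
qed

text \<open>An unclosed \<open>v\<close> would leave an open \<open>w\<close> with \<open>f\<close>
  below \<open>Cstar I\<close>. So OPEN is nonempty and the search has stopped at a goal; the
  \<open>g\<close> of that goal, the cost of an actual solution, would then be below
  \<open>Cstar I\<close>.\<close>

lemma S_less_closed:
  assumes inv: "invariant {} (OPEN \<sigma>) (CLOSED \<sigma>)"
    and v: "v \<in> S_less I \<alpha>"
    and final: "OPEN_min I \<alpha> \<sigma> = {} \<or> OPEN_min I \<alpha> \<sigma> \<inter> goals I \<noteq> {}"
  shows "v \<in> dom (CLOSED \<sigma>)"
proof (rule ccontr)
  assume not_closed: "v \<notin> dom (CLOSED \<sigma>)"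
  obtain p where p: "awalk (start I) p v" and less: "walk_cost p + \<alpha> * heur I v < Cstar I"
    using gstar_less_walk v unfolding S_less_def by blast
  obtain w e where w: "OPEN \<sigma> w = Some e"
    and w_le: "gval e + \<alpha> * heur I w \<le> walk_cost p + \<alpha> * heur I v"
    using frontier[OF inv p alpha_nonneg] alpha_less_one not_closed by auto
  obtain t where t: "t \<in> OPEN_min I \<alpha> \<sigma>" "t \<in> goals I"
    using final OPEN_min_nonempty[OF inv w] by auto
  obtain e' where e': "OPEN \<sigma> t = Some e'"
    using t OPEN_min_subset by fastforce
  obtain q where q: "awalk (start I) q t" "walk_cost q = gval e'"
    using invariant_open_walk[OF inv e'] by blast
  have "gval e' \<le> gval e + \<alpha> * heur I w"
    using OPEN_min_le[OF t(1) w] e' heur_goal[OF t(2)] by (simp add: f_val_def)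
  then have "walk_cost q \<le> walk_cost p + \<alpha> * heur I v"
    using w_le q by simp
  then have "ereal (walk_cost q) < Cstar I"
    using less by (metis ereal_less_eq(3) le_less_trans)
  then show False
    using Cstar_le[OF q(1) t(2)] by simp
qed

section \<open>Runs, termination and the expanded set\<close>

lemma next_expansion_Some:
  assumes "valid_tie_breaker \<tau>"
    and inv: "invariant {} (OPEN (hd H)) (CLOSED (hd H))"
    and "next_expansion I \<alpha> \<tau> \<rho> H = Some u"
  shows "u \<in> OPEN_min I \<alpha> (hd H)" and "OPEN_min I \<alpha> (hd H) \<inter> goals I = {}"
proof -
  let ?C = "OPEN_min I \<alpha> (hd H)"
  have "?C \<noteq> {}" and no_goal: "?C \<inter> goals I = {}" and u: "u = \<tau> \<rho> I H ?C"
    using assms(3) by (auto simp: next_expansion_def Let_def split: if_splits)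
  \<comment> \<open>Validity constrains the tie-breaker on finite nonempty candidate sets
    only.\<close>
  moreover have "finite ?C"
    using finite_subset[OF OPEN_min_subset finite_OPEN[OF inv]] .
  ultimately show "u \<in> ?C"
    using assms(1) unfolding valid_tie_breaker_def by blast
  show "?C \<inter> goals I = {}" by (rule no_goal)
qed

text \<open>The last clause lets membership in CLOSED certify an expansion. Goals stay out of CLOSED
  because a state is expanded only when \<open>OPEN_min\<close> contains no goal.\<close>

lemma run_invariant:
  fixes \<tau> :: "('r, 'v) tie_breaker" and \<rho> :: 'r
  assumes \<tau>: "valid_tie_breaker \<tau>"
  defines "\<sigma> \<equiv> \<lambda>n. hd (run I \<alpha> \<tau> \<rho> n)"
  shows "invariant {} (OPEN (\<sigma> n)) (CLOSED (\<sigma> n)) \<and>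
    dom (CLOSED (\<sigma> n)) \<inter> goals I = {} \<and>
    (\<forall>v \<in> dom (CLOSED (\<sigma> n)). \<exists>m. next_expansion I \<alpha> \<tau> \<rho> (run I \<alpha> \<tau> \<rho> m) = Some v)"
proof (induction n)
  case 0
  have "\<sigma> 0 = init_state I" by (simp add: \<sigma>_def)
  moreover have "CLOSED (init_state I) = Map.empty" by (simp add: init_state_def)
  ultimately show ?case using invariant_init by auto
next
  case (Suc n)
  show ?case
  proof (cases "next_expansion I \<alpha> \<tau> \<rho> (run I \<alpha> \<tau> \<rho> n)")
    case None
    then have "\<sigma> (Suc n) = \<sigma> n" by (simp add: \<sigma>_def Let_def)
    then show ?thesis using Suc by simp
  next
    case (Some u)
    then have "\<sigma> (Suc n) = expand I u (\<sigma> n)" by (simp add: \<sigma>_def Let_def)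
    moreover have "u \<in> OPEN_min I \<alpha> (\<sigma> n)" "OPEN_min I \<alpha> (\<sigma> n) \<inter> goals I = {}"
      using next_expansion_Some[OF \<tau> _ Some] Suc unfolding \<sigma>_def by auto
    ultimately show ?thesis
      using invariant_expand[of "\<sigma> n" u] Suc Some by auto
  qed
qed

text \<open>Every expansion closes a fresh state, so a run without end would close more states than
  the finite graph has.\<close>

lemma run_ends:
  assumes \<tau>: "valid_tie_breaker \<tau>"
  shows "\<exists>n. next_expansion I \<alpha> \<tau> \<rho> (run I \<alpha> \<tau> \<rho> n) = None"
proof (rule ccontr)
  assume no_end: "\<not> ?thesis"
  let ?Cl = "\<lambda>n. dom (CLOSED (hd (run I \<alpha> \<tau> \<rho> n)))"
  have sub: "?Cl n \<subseteq> pverts (state_graph I)" for n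
    using invariant_dom(2)[OF run_invariant[OF \<tau>, THEN conjunct1]] .
  have "card (?Cl n) = n" for n
  proof (induction n)
    case 0
    show ?case by (simp add: init_state_def)
  next
    case (Suc n)
    obtain u where u: "next_expansion I \<alpha> \<tau> \<rho> (run I \<alpha> \<tau> \<rho> n) = Some u"
      using no_end by auto
    have inv: "invariant {} (OPEN (hd (run I \<alpha> \<tau> \<rho> n))) (CLOSED (hd (run I \<alpha> \<tau> \<rho> n)))"
      using run_invariant[OF \<tau>, THEN conjunct1] .
    have "?Cl (Suc n) = insert u (?Cl n)" "u \<notin> ?Cl n"
      using invariant_expand[OF inv next_expansion_Some(1)[OF \<tau> inv u]] u
      by (simp_all add: Let_def)
    moreover have "finite (?Cl n)"
      using finite_subset[OF sub pair_finite_verts] .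
    ultimately show ?case
      using Suc by simp
  qed
  from this[of "Suc (card (pverts (state_graph I)))"] show False
    using card_mono[OF pair_finite_verts sub] by (metis Suc_n_not_le_n)
qed

text \<open>One inclusion looks at the point where a state is selected, the other at the end of the
  run, where all of \<open>S_less I \<alpha>\<close> is closed and every closed state has been
  expanded.\<close>

lemma expanded_eq_S_less:
  assumes "solvable I" and \<tau>: "valid_tie_breaker \<tau>"
  shows "expanded I \<alpha> \<tau> \<rho> = S_less I \<alpha>"
proof
  show "expanded I \<alpha> \<tau> \<rho> \<subseteq> S_less I \<alpha>"
  proof
    fix v assume "v \<in> expanded I \<alpha> \<tau> \<rho>"
    then obtain n where n: "next_expansion I \<alpha> \<tau> \<rho> (run I \<alpha> \<tau> \<rho> n) = Some v"
      unfolding expanded_def by auto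
    have inv: "invariant {} (OPEN (hd (run I \<alpha> \<tau> \<rho> n))) (CLOSED (hd (run I \<alpha> \<tau> \<rho> n)))"
      and "dom (CLOSED (hd (run I \<alpha> \<tau> \<rho> n))) \<inter> goals I = {}"
      by (simp_all add: run_invariant[OF \<tau>])
    then show "v \<in> S_less I \<alpha>"
      using selected_less_Cstar[OF assms(1)] next_expansion_Some[OF \<tau> inv n] by simp
  qed
  obtain n where n: "next_expansion I \<alpha> \<tau> \<rho> (run I \<alpha> \<tau> \<rho> n) = None"
    using run_ends[OF \<tau>] by blast
  then have final: "OPEN_min I \<alpha> (hd (run I \<alpha> \<tau> \<rho> n)) = {} \<or>
      OPEN_min I \<alpha> (hd (run I \<alpha> \<tau> \<rho> n)) \<inter> goals I \<noteq> {}"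
    by (auto simp: next_expansion_def Let_def split: if_splits)
  show "S_less I \<alpha> \<subseteq> expanded I \<alpha> \<tau> \<rho>"
  proof
    fix v assume v: "v \<in> S_less I \<alpha>"
    have "v \<in> dom (CLOSED (hd (run I \<alpha> \<tau> \<rho> n)))"
      using S_less_closed[OF run_invariant[OF \<tau>, THEN conjunct1] v final] .
    then have "\<exists>m. next_expansion I \<alpha> \<tau> \<rho> (run I \<alpha> \<tau> \<rho> m) = Some v"
      using run_invariant[OF \<tau>, THEN conjunct2, THEN conjunct2] by (rule bspec[rotated])
    then show "v \<in> expanded I \<alpha> \<tau> \<rho>"
      using v unfolding expanded_def S_less_def by auto
  qed
qed

end

theorem corollary3:
  fixes I :: "'v search_instance" and \<alpha> :: real
    and \<tau> :: "('r, 'v) tie_breaker" and \<rho> :: 'r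
  assumes "search_instance I"
    and "solvable I"
    and "consistent I"
    and "\<forall>v \<in> goals I. heur I v = 0"
    and "\<forall>v \<in> pverts (state_graph I) - goals I. 0 < heur I v"
    and "0 \<le> \<alpha>" and "\<alpha> < 1"
    and "valid_tie_breaker \<tau>"
  shows "expanded I \<alpha> \<tau> \<rho> = S_less I \<alpha> \<and>
    (\<forall>(\<tau>' :: ('q, 'v) tie_breaker) \<rho>'. valid_tie_breaker \<tau>' \<longrightarrow>
       expanded I \<alpha> \<tau>' \<rho>' = expanded I \<alpha> \<tau> \<rho> \<and>
       expansion_count I \<alpha> \<tau>' \<rho>' = expansion_count I \<alpha> \<tau> \<rho>)"
proof -
  interpret search_instance I by fact
  interpret weighted_astar I \<alpha>
    using assms by unfold_locales auto
  show ?thesis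
    \<comment> \<open>\<open>S_less I \<alpha>\<close> mentions neither tie-breaker nor outcome, and
      \<open>expanded_eq_S_less\<close> is polymorphic in the type of outcomes, so it serves for
      both \<open>\<tau>\<close> and \<open>\<tau>'\<close>.\<close>
    using expanded_eq_S_less[OF assms(2)] assms(8) unfolding expansion_count_def by metis
qed

end
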